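(* Let $(X,G)$ be a topological dynamical system, $m\in\mathbb{N}$ and $\varepsilon_0>0$. Then the following are equivalent. (i) $(X,G)$ is strongly $(\varepsilon,m)$-spreading for all $0<\varepsilon<\varepsilon_0$. (ii) For all $0<\varepsilon<\varepsilon_0$ and $\delta>0$ there exist $N=N(\varepsilon,\delta)\in\mathbb{N}$ and $x^{(1)},\dots,x^{(N)}\in X^m_{\varepsilon}$ such that $$\underline{\mathrm{BD}}\left(\left\{g\in G : \exists k\in\{1,\dots,N\}\text{ with } gU\cap B\left(x^{(k)}_i,\delta\right)\ne\emptyset\text{ for all } i=1,\dots,m\right\}\right)=1$$ holds for all nonempty open sets $U\subseteq X$.
   Context: A topological dynamical system (tds) $(X,G)$ consists of a compact metric space $X$ with metric $d$ and a countably infinite discrete amenable group $G$ acting on $X$ by homeomorphisms; $gU=\{gx : x\in U\}$. $B(x,\delta)$ is the open ball of radius $\delta$ around $x$. $\mathbb{N}=\{1,2,\dots\}$. A Følner sequence is a sequence $\mathcal{F}=(\mathcal{F}_n)_{n\in\mathbb{N}}$ of nonempty finite subsets of $G$ with $\lim_{n\to\infty}|\mathcal{F}_n\triangle K\mathcal{F}_n|/|\mathcal{F}_n|=0$ for every nonempty finite $K\subseteq G$. For $S\subseteq G$ the lower Banach density is $\underline{\mathrm{BD}}(S)=\inf_{\mathcal{F}}\liminf_{n\to\infty}|S\cap\mathcal{F}_n|/|\mathcal{F}_n|$, the infimum being over all Følner sequences of $G$. For $x=(x_1,\dots,x_m)\in X^m$ let $D_m(x)=\min_{1\le i<j\le m}d(x_i,x_j)$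 (with $\min\emptyset=+\infty$, relevant only for $m=1$); for $A\subseteq X$ let $\mathrm{Diam}_m(A)=\sup\{D_m(x) : x\in A^m\}$; and let $X^m_\varepsilon=\{x\in X^m : D_m(x)\ge\varepsilon\}$. The components of $x^{(k)}\in X^m$ are $x^{(k)}_1,\dots,x^{(k)}_m$. For $\varepsilon>0$, $(X,G)$ is strongly $(\varepsilon,m)$-spreading if $\underline{\mathrm{BD}}(\{g\in G : \mathrm{Diam}_m(gU)>\varepsilon\})=1$ for every nonempty open $U\subseteq X$. *)

theory Defs
  imports "HOL-Analysis.Analysis" "HOL-Algebra.Group_Action"
begin

text \<open>
  A discrete group is amenable if it carries a finitely additive, left-invariant probability
  measure defined on all of its subsets.
\<close>

definition amenable :: "('g, 'b) monoid_scheme \<Rightarrow> bool" where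
  "amenable G \<longleftrightarrow> group G \<and>
     (\<exists>\<mu> :: 'g set \<Rightarrow> real.
        (\<forall>A. A \<subseteq> carrier G \<longrightarrow> 0 \<le> \<mu> A) \<and>
        \<mu> (carrier G) = 1 \<and>
        (\<forall>A B. A \<subseteq> carrier G \<longrightarrow> B \<subseteq> carrier G \<longrightarrow> A \<inter> B = {} \<longrightarrow> \<mu> (A \<union> B) = \<mu> A + \<mu> B) \<and>
        (\<forall>g A. g \<in> carrier G \<longrightarrow> A \<subseteq> carrier G \<longrightarrow> \<mu> (g <#\<^bsub>G\<^esub> A) = \<mu> A))"

text \<open>
  The phase space is a nonempty compact subset of an ambient metric space, carrying the
  restricted metric.  The group element \<open>g\<close> acts as \<open>\<phi> g\<close>, so \<open>gU\<close> is \<open>\<phi> g ` U\<close>.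
\<close>

locale topological_dynamical_system = group_action G X \<phi>
  for G :: "('g, 'b) monoid_scheme" (structure)
    and X :: "'x::metric_space set"
    and \<phi> :: "'g \<Rightarrow> 'x \<Rightarrow> 'x" +
  assumes nonempty: "X \<noteq> {}"
    and compact: "compact X"
    and countable: "countable (carrier G)"
    and infinite: "infinite (carrier G)"
    and amenable: "amenable G"
    and homeomorphic: "g \<in> carrier G \<Longrightarrow>
      homeomorphic_map (top_of_set X) (top_of_set X) (\<phi> g)"

definition folner_sequence :: "('g, 'b) monoid_scheme \<Rightarrow> (nat \<Rightarrow> 'g set) \<Rightarrow> bool" where
  "folner_sequence G F \<longleftrightarrow>
     (\<forall>n. F n \<subseteq> carrier G \<and> finite (F n) \<and> F n \<noteq> {}) \<and>
     (\<forall>K. K \<subseteq> carrier G \<longrightarrow> finite K \<longrightarrow> K \<noteq> {} \<longrightarrow>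
        (\<lambda>n. real (card (sym_diff (F n) (K <#>\<^bsub>G\<^esub> F n))) / real (card (F n))) \<longlonglongrightarrow> 0)"

definition lower_BD :: "('g, 'b) monoid_scheme \<Rightarrow> 'g set \<Rightarrow> ereal" where
  "lower_BD G S =
     (INF F \<in> {F. folner_sequence G F}.
        liminf (\<lambda>n. ereal (real (card (S \<inter> F n)) / real (card (F n)))))"

text \<open>
  The \<open>m\<close>-tuples over \<open>A\<close> are the elements of \<open>{1..m} \<rightarrow>\<^sub>E A\<close>.  The minimum of
  distances is an infimum over a finite set in \<^typ>\<open>ereal\<close>, hence \<open>\<infinity>\<close> for \<open>m = 1\<close>.
\<close>

definition min_dist :: "nat \<Rightarrow> (nat \<Rightarrow> 'x::metric_space) \<Rightarrow> ereal" where
  "min_dist m x = (INF (i, j) \<in> {(i, j). 1 \<le> i \<and> i < j \<and> j \<le> m}. ereal (dist (x i) (x j)))"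

definition Diam :: "nat \<Rightarrow> 'x::metric_space set \<Rightarrow> ereal" where
  "Diam m A = (SUP x \<in> {1..m} \<rightarrow>\<^sub>E A. min_dist m x)"

definition separated_tuples :: "'x::metric_space set \<Rightarrow> nat \<Rightarrow> real \<Rightarrow> (nat \<Rightarrow> 'x) set" where
  "separated_tuples X m \<epsilon> = {x \<in> {1..m} \<rightarrow>\<^sub>E X. min_dist m x \<ge> ereal \<epsilon>}"

definition strongly_spreading ::
  "('g, 'b) monoid_scheme \<Rightarrow> 'x::metric_space set \<Rightarrow> ('g \<Rightarrow> 'x \<Rightarrow> 'x) \<Rightarrow> real \<Rightarrow> nat \<Rightarrow> bool" where
  "strongly_spreading G X \<phi> \<epsilon> m \<longleftrightarrow>
     (\<forall>U. openin (top_of_set X) U \<longrightarrow> U \<noteq> {} \<longrightarrow>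
        lower_BD G {g \<in> carrier G. Diam m (\<phi> g ` U) > ereal \<epsilon>} = 1)"

end

theory Submission
  imports Defs
begin

text \<open>
  Both conditions concern nearly the same sets of group elements, up to an arbitrarily small
  change of \<open>\<epsilon>\<close>, so the equivalence reduces to inclusions between such sets together with the
  fact that lower Banach density one passes to larger sets (\<open>lower_BD_one_superset\<close>).

  From spreading to approximation (\<open>approximation_if_strongly_spreading\<close>): if \<open>gU\<close> has
  \<open>m\<close>-diameter larger than \<open>\<epsilon>\<close>, then it contains an \<open>\<epsilon>\<close>-separated tuple.  As the phase space is
  totally bounded, there are finitely many \<open>\<epsilon>\<close>-separated tuples such that every other one is
  coordinatewise within \<open>\<delta>\<close> of one of them (\<open>finite_tuple_net\<close>), so \<open>gU\<close> meets all the \<open>\<delta>\<close>-balls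
  around the coordinates of that one.  This finite family does not depend on \<open>U\<close>.

  From approximation to spreading: given \<open>\<epsilon> < \<epsilon>\<^sub>0\<close>, use the approximation at some \<open>\<epsilon>'\<close> strictly
  between them and a \<open>\<delta>\<close> with \<open>2\<delta> < \<epsilon>' - \<epsilon>\<close>.  Points of \<open>gU\<close> in the \<open>\<delta>\<close>-balls around an
  \<open>\<epsilon>'\<close>-separated tuple are then at least \<open>\<epsilon>' - 2\<delta> > \<epsilon>\<close> apart
  (\<open>Diam_greater_if_near_separated_tuple\<close>).
\<close>

lemma lower_BD_mono:
  assumes "S \<subseteq> T"
  shows "lower_BD G S \<le> lower_BD G T"
  unfolding lower_BD_def
proof (rule INF_mono)
  fix F assume F: "F \<in> {F. folner_sequence G F}"
  have "card (S \<inter> F n) \<le> card (T \<inter> F n)" for n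
    using F assms by (intro card_mono) (auto simp: folner_sequence_def)
  then have "liminf (\<lambda>n. ereal (real (card (S \<inter> F n)) / real (card (F n))))
      \<le> liminf (\<lambda>n. ereal (real (card (T \<inter> F n)) / real (card (F n))))"
    by (intro Liminf_mono always_eventually) (simp add: divide_right_mono)
  then show "\<exists>F'\<in>{F. folner_sequence G F}.
      liminf (\<lambda>n. ereal (real (card (S \<inter> F' n)) / real (card (F' n))))
      \<le> liminf (\<lambda>n. ereal (real (card (T \<inter> F n)) / real (card (F n))))"
    using F by blast
qed

lemma lower_BD_le_one:
  assumes "folner_sequence G F"
  shows "lower_BD G S \<le> 1"
proof -
  have "card (S \<inter> F n) \<le> card (F n)" for n
    using assms by (intro card_mono) (auto simp: folner_sequence_def)
  then have "liminf (\<lambda>n. ereal (real (card (S \<inter> F n)) / real (card (F n)))) \<le> liminf (\<lambda>n. 1)"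
    by (intro Liminf_mono always_eventually) (auto simp: divide_le_eq_1)
  then have "liminf (\<lambda>n. ereal (real (card (S \<inter> F n)) / real (card (F n)))) \<le> 1"
    by (simp add: Liminf_const)
  then show ?thesis
    unfolding lower_BD_def using assms by (intro INF_lower2[of F]) auto
qed

text \<open>
  A value other than \<open>\<infinity>\<close> is only possible if the infimum ranges over a nonempty family; hence a
  density equal to one provides a Foelner sequence.
\<close>

lemma lower_BD_one_imp_folner:
  assumes "lower_BD G S = 1"
  obtains F where "folner_sequence G F"
proof -
  have "{F. folner_sequence G F} \<noteq> {}"
  proof
    assume "{F. folner_sequence G F} = {}"
    then have "lower_BD G S = \<infinity>"
      unfolding lower_BD_def by (simp only: image_empty Inf_empty top_ereal_def)
    with assms show False
      by simp
  qed
  then show thesis using that by blast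
qed

text \<open>
  Density one of the smaller set also supplies the upper bound for the larger one: without a
  Foelner sequence every density would be \<open>\<infinity>\<close>.
\<close>

lemma lower_BD_one_superset:
  assumes "lower_BD G S = 1" and "S \<subseteq> T"
  shows "lower_BD G T = 1"
  using lower_BD_one_imp_folner[OF assms(1)] lower_BD_le_one lower_BD_mono[OF assms(2)] assms(1)
  by (metis order_antisym)

lemma lower_BD_one_imp_nonempty:
  assumes "lower_BD G S = 1"
  shows "S \<noteq> {}"
proof
  assume "S = {}"
  obtain F where F: "folner_sequence G F"
    using lower_BD_one_imp_folner[OF assms] .
  have "lower_BD G {} \<le> liminf (\<lambda>n. ereal (real (card ({} \<inter> F n)) / real (card (F n))))"
    unfolding lower_BD_def using F by (intro INF_lower) auto
  also have "\<dots> = 0"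
    by (simp add: Liminf_const zero_ereal_def)
  finally show False
    using assms \<open>S = {}\<close> by simp
qed

lemma Diam_greater_imp_separated_tuple:
  assumes "Diam m A > ereal \<epsilon>" and "A \<subseteq> X"
  obtains y where "y \<in> separated_tuples X m \<epsilon>" and "\<And>i. i \<in> {1..m} \<Longrightarrow> y i \<in> A"
proof -
  obtain y where y: "y \<in> {1..m} \<rightarrow>\<^sub>E A" "min_dist m y > ereal \<epsilon>"
    using assms(1) unfolding Diam_def less_SUP_iff by blast
  then have "y \<in> {1..m} \<rightarrow>\<^sub>E X"
    using assms(2) by (auto simp: PiE_iff)
  with y show thesis
    by (intro that[of y]) (auto simp: separated_tuples_def PiE_iff)
qed

lemma separated_tuplesD:
  assumes "x \<in> separated_tuples X m \<epsilon>" and "1 \<le> i" "i < j" "j \<le> m"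
  shows "\<epsilon> \<le> dist (x i) (x j)"
proof -
  have "ereal \<epsilon> \<le> min_dist m x"
    using assms(1) by (simp add: separated_tuples_def)
  also have "\<dots> \<le> ereal (dist (x i) (x j))"
    unfolding min_dist_def using assms(2-4) by (intro INF_lower2[of "(i, j)"]) auto
  finally show ?thesis by simp
qed

lemma Diam_greater_if_near_separated_tuple:
  assumes x: "x \<in> separated_tuples X m \<epsilon>'"
    and \<delta>: "\<epsilon> < \<epsilon>' - 2 * \<delta>"
    and near: "\<And>i. i \<in> {1..m} \<Longrightarrow> A \<inter> ball (x i) \<delta> \<noteq> {}"
  shows "Diam m A > ereal \<epsilon>"
proof -
  have "\<forall>i\<in>{1..m}. \<exists>a. a \<in> A \<and> dist (x i) a < \<delta>"
    using near by fastforce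
  then obtain a where a: "\<And>i. i \<in> {1..m} \<Longrightarrow> a i \<in> A \<and> dist (x i) (a i) < \<delta>"
    by metis
  define y where "y = restrict a {1..m}"
  have "y \<in> {1..m} \<rightarrow>\<^sub>E A"
    using a by (auto simp: y_def)
  moreover have "ereal (\<epsilon>' - 2 * \<delta>) \<le> min_dist m y"
    unfolding min_dist_def
  proof (rule INF_greatest, clarify)
    fix i j :: nat assume ij: "1 \<le> i" "i < j" "j \<le> m"
    have "\<epsilon>' \<le> dist (x i) (x j)"
      using separated_tuplesD[OF x ij] .
    moreover have "dist (x i) (a i) < \<delta>" "dist (x j) (a j) < \<delta>"
      using a ij by auto
    moreover have "dist (x i) (x j) \<le> dist (x i) (a i) + dist (a i) (a j) + dist (x j) (a j)"
      by metric
    ultimately show "ereal (\<epsilon>' - 2 * \<delta>) \<le> ereal (dist (y i) (y j))"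
      using ij by (simp add: y_def)
  qed
  ultimately have "ereal (\<epsilon>' - 2 * \<delta>) \<le> Diam m A"
    unfolding Diam_def by (intro SUP_upper2[of y])
  then show ?thesis
    using \<delta> by (metis less_ereal.simps(1) less_le_trans)
qed

text \<open>
  Total boundedness of finite powers, with the net chosen inside the given set: a finite
  \<open>\<delta>/2\<close>-net \<open>C\<close> of the base space has only finitely many \<open>m\<close>-tuples, and for each of them that has
  a member of \<open>Y\<close> within \<open>\<delta>/2\<close> it suffices to keep one such member.
\<close>

lemma finite_tuple_net:
  fixes X :: "'x::metric_space set"
  assumes "compact X" and "\<delta> > 0" and "Y \<subseteq> {1..m} \<rightarrow>\<^sub>E X"
  obtains T where "finite T" "T \<subseteq> Y" "\<And>y. y \<in> Y \<Longrightarrow> \<exists>t\<in>T. \<forall>i\<in>{1..m::nat}. dist (t i) (y i) < \<delta>"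
proof -
  obtain C where C: "finite C" "X \<subseteq> (\<Union>c\<in>C. ball c (\<delta>/2))"
    using assms(1,2) unfolding compact_eq_totally_bounded by (metis half_gt_zero)
  define near where "near c y \<longleftrightarrow> (\<forall>i\<in>{1..m}. dist (c i) (y i) < \<delta>/2)" for c y :: "nat \<Rightarrow> 'x"
  define D where "D = {c \<in> {1..m} \<rightarrow>\<^sub>E C. \<exists>y\<in>Y. near c y}"
  have "\<forall>c\<in>D. \<exists>y. y \<in> Y \<and> near c y"
    by (auto simp: D_def)
  then obtain pick where pick: "\<And>c. c \<in> D \<Longrightarrow> pick c \<in> Y \<and> near c (pick c)"
    by metis
  show thesis
  proof (rule that[of "pick ` D"])
    have "finite ({1..m} \<rightarrow>\<^sub>E C)"
      using C(1) by (intro finite_PiE) auto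
    then show "finite (pick ` D)"
      by (simp add: D_def)
    show "pick ` D \<subseteq> Y"
      using pick by auto
    fix y assume y: "y \<in> Y"
    then have "\<forall>i\<in>{1..m}. \<exists>c\<in>C. dist c (y i) < \<delta>/2"
      using C(2) assms(3) by (fastforce simp: PiE_iff)
    then obtain c where c: "\<And>i. i \<in> {1..m} \<Longrightarrow> c i \<in> C \<and> dist (c i) (y i) < \<delta>/2"
      by metis
    define c' where "c' = restrict c {1..m}"
    have c'y: "near c' y"
      using c by (simp add: near_def c'_def)
    moreover have "c' \<in> {1..m} \<rightarrow>\<^sub>E C"
      using c by (auto simp: c'_def)
    ultimately have "c' \<in> D"
      using y by (auto simp: D_def)
    moreover have "dist (pick c' i) (y i) < \<delta>" if "i \<in> {1..m}" for i
    proof -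
      have "dist (c' i) (pick c' i) < \<delta>/2" "dist (c' i) (y i) < \<delta>/2"
        using pick[OF \<open>c' \<in> D\<close>] c'y that by (auto simp: near_def)
      then show ?thesis
        by (rule dist_triangle_half_r)
    qed
    ultimately show "\<exists>t\<in>pick ` D. \<forall>i\<in>{1..m}. dist (t i) (y i) < \<delta>"
      by blast
  qed
qed

lemma (in topological_dynamical_system) action_image_subset:
  assumes "g \<in> carrier G" and "openin (top_of_set X) U"
  shows "\<phi> g ` U \<subseteq> X"
  using element_image[OF assms(1)] openin_imp_subset[OF assms(2)] by blast

lemma (in topological_dynamical_system) approximation_if_strongly_spreading:
  assumes spread: "strongly_spreading G X \<phi> \<epsilon> m" and "\<delta> > 0"
  shows "\<exists>N::nat. N \<ge> 1 \<and>
    (\<exists>x. (\<forall>k\<in>{1..N}. x k \<in> separated_tuples X m \<epsilon>) \<and>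
      (\<forall>U. openin (top_of_set X) U \<and> U \<noteq> {} \<longrightarrow>
        lower_BD G {g \<in> carrier G.
          \<exists>k\<in>{1..N}. \<forall>i\<in>{1..m}. \<phi> g ` U \<inter> ball (x k i) \<delta> \<noteq> {}} = 1))"
proof -
  have density: "lower_BD G {g \<in> carrier G. Diam m (\<phi> g ` U) > ereal \<epsilon>} = 1"
    if "openin (top_of_set X) U" "U \<noteq> {}" for U
    using spread that by (simp add: strongly_spreading_def)
  have "separated_tuples X m \<epsilon> \<subseteq> {1..m} \<rightarrow>\<^sub>E X"
    by (auto simp: separated_tuples_def)
  then obtain T where T: "finite T" "T \<subseteq> separated_tuples X m \<epsilon>"
    and net: "\<And>y. y \<in> separated_tuples X m \<epsilon> \<Longrightarrow> \<exists>t\<in>T. \<forall>i\<in>{1..m}. dist (t i) (y i) < \<delta>"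
    using finite_tuple_net[OF compact assms(2)] by metis
  \<comment> \<open>Every translate that spreads meets the balls around one member of the net; applied to \<open>X\<close>
    itself, this also shows that the net is nonempty.\<close>
  have near: "\<exists>t\<in>T. \<forall>i\<in>{1..m}. \<phi> g ` U \<inter> ball (t i) \<delta> \<noteq> {}"
    if U: "openin (top_of_set X) U" and g: "g \<in> carrier G" "Diam m (\<phi> g ` U) > ereal \<epsilon>" for U g
  proof -
    obtain y where y: "y \<in> separated_tuples X m \<epsilon>" "\<And>i. i \<in> {1..m} \<Longrightarrow> y i \<in> \<phi> g ` U"
      using Diam_greater_imp_separated_tuple[OF g(2) action_image_subset[OF g(1) U]] by blast
    then obtain t where "t \<in> T" "\<forall>i\<in>{1..m}. dist (t i) (y i) < \<delta>"
      using net by blast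
    then show ?thesis
      using y(2) by (metis IntI empty_iff mem_ball)
  qed
  have "openin (top_of_set X) X"
    by simp
  from lower_BD_one_imp_nonempty[OF density[OF this nonempty]] near[OF this]
  have "T \<noteq> {}"
    by blast
  obtain h where h: "bij_betw h {1..card T} T"
    using finite_same_card_bij[of "{1..card T}" T] T(1) by auto
  show ?thesis
  proof (intro exI[of _ "card T"] exI[of _ h] conjI ballI allI impI)
    show "card T \<ge> 1"
      using T(1) \<open>T \<noteq> {}\<close> by (simp add: Suc_le_eq card_gt_0_iff)
    show "h k \<in> separated_tuples X m \<epsilon>" if "k \<in> {1..card T}" for k
      using bij_betwE[OF h] that T(2) by blast
    fix U assume "openin (top_of_set X) U \<and> U \<noteq> {}"
    then have U: "openin (top_of_set X) U" "U \<noteq> {}"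
      by auto
    have "\<exists>k\<in>{1..card T}. \<forall>i\<in>{1..m}. \<phi> g ` U \<inter> ball (h k i) \<delta> \<noteq> {}"
      if g: "g \<in> carrier G" "Diam m (\<phi> g ` U) > ereal \<epsilon>" for g
    proof -
      obtain t where "t \<in> T" "\<forall>i\<in>{1..m}. \<phi> g ` U \<inter> ball (t i) \<delta> \<noteq> {}"
        using near[OF U(1) g] by blast
      moreover obtain k where "k \<in> {1..card T}" "t = h k"
        using \<open>t \<in> T\<close> bij_betw_imp_surj_on[OF h] by blast
      ultimately show ?thesis
        by blast
    qed
    then show "lower_BD G {g \<in> carrier G.
        \<exists>k\<in>{1..card T}. \<forall>i\<in>{1..m}. \<phi> g ` U \<inter> ball (h k i) \<delta> \<noteq> {}} = 1"
      by (intro lower_BD_one_superset[OF density[OF U]]) blast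
  qed
qed

theorem proposition5p5:
  fixes G :: "('g, 'b) monoid_scheme"
    and X :: "'x::metric_space set"
    and \<phi> :: "'g \<Rightarrow> 'x \<Rightarrow> 'x"
    and m :: nat
    and \<epsilon>\<^sub>0 :: real
  assumes "topological_dynamical_system G X \<phi>"
    and "m \<ge> 1"
    and "\<epsilon>\<^sub>0 > 0"
  shows "(\<forall>\<epsilon>. 0 < \<epsilon> \<and> \<epsilon> < \<epsilon>\<^sub>0 \<longrightarrow> strongly_spreading G X \<phi> \<epsilon> m)
    \<longleftrightarrow>
    (\<forall>\<epsilon> \<delta>. 0 < \<epsilon> \<and> \<epsilon> < \<epsilon>\<^sub>0 \<and> 0 < \<delta> \<longrightarrow>
      (\<exists>N::nat. N \<ge> 1 \<and>
        (\<exists>x :: nat \<Rightarrow> nat \<Rightarrow> 'x.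
          (\<forall>k\<in>{1..N}. x k \<in> separated_tuples X m \<epsilon>) \<and>
          (\<forall>U. openin (top_of_set X) U \<and> U \<noteq> {} \<longrightarrow>
            lower_BD G {g \<in> carrier G.
              \<exists>k\<in>{1..N}. \<forall>i\<in>{1..m}. \<phi> g ` U \<inter> ball (x k i) \<delta> \<noteq> {}} = 1))))"
proof
  interpret topological_dynamical_system G X \<phi>
    by (fact assms(1))
  assume spread: "\<forall>\<epsilon>. 0 < \<epsilon> \<and> \<epsilon> < \<epsilon>\<^sub>0 \<longrightarrow> strongly_spreading G X \<phi> \<epsilon> m"
  show "\<forall>\<epsilon> \<delta>. 0 < \<epsilon> \<and> \<epsilon> < \<epsilon>\<^sub>0 \<and> 0 < \<delta> \<longrightarrow>
      (\<exists>N::nat. N \<ge> 1 \<and>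
        (\<exists>x :: nat \<Rightarrow> nat \<Rightarrow> 'x.
          (\<forall>k\<in>{1..N}. x k \<in> separated_tuples X m \<epsilon>) \<and>
          (\<forall>U. openin (top_of_set X) U \<and> U \<noteq> {} \<longrightarrow>
            lower_BD G {g \<in> carrier G.
              \<exists>k\<in>{1..N}. \<forall>i\<in>{1..m}. \<phi> g ` U \<inter> ball (x k i) \<delta> \<noteq> {}} = 1)))"
    using spread by (intro allI impI approximation_if_strongly_spreading) auto
next
  assume approx: "\<forall>\<epsilon> \<delta>. 0 < \<epsilon> \<and> \<epsilon> < \<epsilon>\<^sub>0 \<and> 0 < \<delta> \<longrightarrow>
      (\<exists>N::nat. N \<ge> 1 \<and>
        (\<exists>x :: nat \<Rightarrow> nat \<Rightarrow> 'x.
          (\<forall>k\<in>{1..N}. x k \<in> separated_tuples X m \<epsilon>) \<and>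
          (\<forall>U. openin (top_of_set X) U \<and> U \<noteq> {} \<longrightarrow>
            lower_BD G {g \<in> carrier G.
              \<exists>k\<in>{1..N}. \<forall>i\<in>{1..m}. \<phi> g ` U \<inter> ball (x k i) \<delta> \<noteq> {}} = 1)))"
  show "\<forall>\<epsilon>. 0 < \<epsilon> \<and> \<epsilon> < \<epsilon>\<^sub>0 \<longrightarrow> strongly_spreading G X \<phi> \<epsilon> m"
  proof (intro allI impI)
    fix \<epsilon> assume \<epsilon>: "0 < \<epsilon> \<and> \<epsilon> < \<epsilon>\<^sub>0"
    then obtain \<epsilon>' where \<epsilon>': "\<epsilon> < \<epsilon>'" "\<epsilon>' < \<epsilon>\<^sub>0"
      using dense by blast
    define \<delta> where "\<delta> = (\<epsilon>' - \<epsilon>) / 3"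
    have \<delta>: "0 < \<delta>" "\<epsilon> < \<epsilon>' - 2 * \<delta>"
      using \<epsilon>' by (auto simp: \<delta>_def field_simps)
    have "0 < \<epsilon>' \<and> \<epsilon>' < \<epsilon>\<^sub>0 \<and> 0 < \<delta>"
      using \<epsilon> \<epsilon>' \<delta>(1) by simp
    from approx[THEN spec, THEN spec, THEN mp, OF this]
    obtain N :: nat and x where sep: "\<forall>k\<in>{1..N}. x k \<in> separated_tuples X m \<epsilon>'"
      and density: "\<forall>U. openin (top_of_set X) U \<and> U \<noteq> {} \<longrightarrow>
        lower_BD G {g \<in> carrier G.
          \<exists>k\<in>{1..N}. \<forall>i\<in>{1..m}. \<phi> g ` U \<inter> ball (x k i) \<delta> \<noteq> {}} = 1"
      by (elim exE conjE)
    have "Diam m A > ereal \<epsilon>" if "k \<in> {1..N}" "\<forall>i\<in>{1..m}. A \<inter> ball (x k i) \<delta> \<noteq> {}" for k A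
      using Diam_greater_if_near_separated_tuple[OF _ \<delta>(2)] sep that by blast
    then show "strongly_spreading G X \<phi> \<epsilon> m"
      unfolding strongly_spreading_def
      by (intro allI impI lower_BD_one_superset[OF density[THEN spec, THEN mp]]) auto
  qed
qed

end
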